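(* For every integer $n\ge0$ and $\beta\in\mathbb{C}$, as linear maps on polynomials of degree at most $n$, $$U_nE^{n\beta}U_n^{-1}=V_n^{-1}B_{n\beta}V_n,$$ where $B_{n\beta}$ is the linear map $x^p\mapsto\sum_{i=0}^{p}\binom{n\beta}{p-i}x^i$ (the transpose of the Riordan matrix $((1+x)^{n\beta},x)$).
   Context: Polynomials over $\mathbb{C}$; $\binom{y}{k}=y(y-1)\cdots(y-k+1)/k!$. $U_nx^p=\frac{(1-x)^{n+1}}{n!}\sum_{m\ge0}m^px^m$ ($0\le p\le n$, $0^0=1$), inverse $U_n^{-1}x^p=(x)_p[x+1]_{n-p}$ with $(y)_p=y(y-1)\cdots(y-p+1)$, $[y]_k=y(y+1)\cdots(y+k-1)$. $E^{\gamma}c(x)=c(x+\gamma)$. $V_nc(x)=(1+x)^nc\big(\frac{x}{1+x}\big)$, $V_n^{-1}c(x)=(1-x)^nc\big(\frac{x}{1-x}\big)$. *)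

theory Defs
  imports "HOL-Computational_Algebra.Computational_Algebra" Complex_Main
begin

definition polys_upto :: "nat \<Rightarrow> complex poly set" where
  "polys_upto n = {c. degree c \<le> n}"

text \<open>The image of \<open>x ^ p\<close> under \<open>U\<^sub>n\<close> is a product of formal power series that happens to be a
  polynomial when \<open>p \<le> n\<close>; the description determines it uniquely, see \<open>U_monom_unique\<close> and
  \<open>fps_U_monom\<close> below. The convention \<open>0 ^ 0 = 1\<close> is that of the library.\<close>

definition U_monom :: "nat \<Rightarrow> nat \<Rightarrow> complex poly" where
  "U_monom n p = (THE q. fps_of_poly q =
     fps_const (1 / fact n) * (1 - fps_X) ^ (n + 1) * Abs_fps (\<lambda>m. of_nat m ^ p))"

definition U :: "nat \<Rightarrow> complex poly \<Rightarrow> complex poly" where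
  "U n c = (\<Sum>p\<le>n. smult (coeff c p) (U_monom n p))"

text \<open>The inverse on polynomials of degree at most \<open>n\<close>; \<open>U n\<close> is a bijection there
  (\<open>bij_betw_U\<close>), and \<open>U_inv_monom\<close> gives the explicit values.\<close>

definition U_inv :: "nat \<Rightarrow> complex poly \<Rightarrow> complex poly" where
  "U_inv n = inv_into (polys_upto n) (U n)"

definition E :: "complex \<Rightarrow> complex poly \<Rightarrow> complex poly" where
  "E \<gamma> c = pcompose c [:\<gamma>, 1:]"

text \<open>\<open>V n c\<close> is the polynomial agreeing with \<open>(1 + x) ^ n * c (x / (1 + x))\<close> wherever this
  expression is meaningful; it exists and is unique for \<open>degree c \<le> n\<close>, see \<open>V_eqI\<close> and
  \<open>poly_V\<close>.\<close>

definition V :: "nat \<Rightarrow> complex poly \<Rightarrow> complex poly" where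
  "V n c = (THE q. \<forall>x. 1 + x \<noteq> 0 \<longrightarrow> poly q x = (1 + x) ^ n * poly c (x / (1 + x)))"

text \<open>Again a genuine inverse (\<open>bij_betw_V\<close>), with the explicit formula in \<open>poly_V_inv\<close>.\<close>

definition V_inv :: "nat \<Rightarrow> complex poly \<Rightarrow> complex poly" where
  "V_inv n = inv_into (polys_upto n) (V n)"

definition B :: "complex \<Rightarrow> complex poly \<Rightarrow> complex poly" where
  "B \<gamma> c = (\<Sum>p\<le>degree c. smult (coeff c p) (\<Sum>i\<le>p. monom (\<gamma> gchoose (p - i)) i))"


subsection \<open>Well-definedness of \<open>U\<close> and its inverse\<close>

lemma U_monom_unique:
  fixes f :: "complex fps"
  assumes "fps_of_poly q = f"
  shows "(THE q. fps_of_poly q = f) = q"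
  using assms by (intro the_equality) (auto simp: fps_of_poly_eq_iff)

lemma eulerian_ex:
  "\<exists>q::complex poly. degree q \<le> p \<and>
     fps_of_poly q = (1 - fps_X) ^ (p + 1) * Abs_fps (\<lambda>m. of_nat m ^ p)"
proof (induction p)
  case 0
  have "(1 - fps_X) * Abs_fps (\<lambda>m. 1 :: complex) = 1"
    by (rule fps_ext) (simp add: algebra_simps fps_X_mult_nth)
  thus ?case by (intro exI[of _ 1]) simp
next
  case (Suc p)
  define F where "F = Abs_fps (\<lambda>m. of_nat m ^ p :: complex)"
  from Suc obtain q where q: "degree q \<le> p" "fps_of_poly q = (1 - fps_X) ^ (p + 1) * F"
    unfolding F_def by blast
  have F': "Abs_fps (\<lambda>m. of_nat m ^ Suc p :: complex) = fps_X * fps_deriv F"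
    by (rule fps_ext) (auto simp: F_def power_Suc)
  define r where "r = pderiv q * [:1, -1:] + smult (of_nat (p + 1)) q"
  have X: "fps_of_poly [:1, -1 :: complex:] = 1 - fps_X"
    by (simp add: fps_of_poly_linear')
  have D: "fps_deriv ((1 - fps_X) ^ (p + 1)) = - (of_nat (p + 1) * (1 - fps_X :: complex fps) ^ p)"
    by (subst fps_deriv_power') (simp del: of_nat_add of_nat_Suc)
  have "fps_deriv (fps_of_poly q) = (1 - fps_X) ^ (p + 1) * fps_deriv F
      - of_nat (p + 1) * (1 - fps_X) ^ p * F"
    unfolding q(2) fps_deriv_mult D by (simp add: mult_ac del: of_nat_add of_nat_Suc)
  hence "fps_of_poly r = (1 - fps_X) ^ (p + 2) * fps_deriv F"
  proof -
    define Z :: "complex fps" where "Z = 1 - fps_X"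
    define N :: "complex fps" where "N = of_nat (p + 1)"
    assume d: "fps_deriv (fps_of_poly q) = (1 - fps_X) ^ (p + 1) * fps_deriv F
        - of_nat (p + 1) * (1 - fps_X) ^ p * F"
    have "fps_of_poly r = fps_deriv (fps_of_poly q) * Z + N * (Z ^ (p + 1) * F)"
      by (simp only: r_def fps_of_poly_add fps_of_poly_mult fps_of_poly_pderiv fps_of_poly_smult
          X q(2) Z_def N_def fps_of_nat)
    also have "\<dots> = Z ^ (p + 2) * fps_deriv F"
      unfolding d Z_def[symmetric] N_def[symmetric] by (simp add: algebra_simps)
    finally show ?thesis by (simp only: Z_def)
  qed
  moreover have "degree r \<le> p"
  proof -
    have "degree (pderiv q * [:1, -1:]) \<le> p"
    proof (cases "pderiv q = 0")
      case False
      hence "degree q > 0" by (metis gr0I pderiv_eq_0_iff)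
      have "degree (pderiv q * [:1, -1:]) \<le> degree (pderiv q) + degree [:1, -1::complex:]"
        by (rule degree_mult_le)
      also have "\<dots> \<le> p" using \<open>degree q > 0\<close> q(1) by (simp add: degree_pderiv)
      finally show ?thesis .
    qed simp
    thus ?thesis unfolding r_def using q(1)
      by (intro degree_add_le) (auto intro: order_trans[OF degree_smult_le])
  qed
  ultimately show ?case
    unfolding F' by (intro exI[of _ "pCons 0 r"])
       (auto simp: fps_of_poly_pCons mult_ac intro: order_trans[OF degree_pCons_le])
qed

lemma U_monom_spec:
  assumes "p \<le> n"
  shows fps_U_monom: "fps_of_poly (U_monom n p) =
      fps_const (1 / fact n) * (1 - fps_X) ^ (n + 1) * Abs_fps (\<lambda>m. of_nat m ^ p)" (is ?A)
    and degree_U_monom: "degree (U_monom n p) \<le> n" (is ?B)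
proof -
  obtain q :: "complex poly" where q: "degree q \<le> p"
    "fps_of_poly q = (1 - fps_X) ^ (p + 1) * Abs_fps (\<lambda>m. of_nat m ^ p)"
    using eulerian_ex by blast
  define r where "r = smult (1 / fact n) ([:1, -1:] ^ (n - p) * q)"
  have X: "fps_of_poly [:1, -1 :: complex:] = 1 - fps_X"
    by (simp add: fps_of_poly_linear')
  have "(1 - fps_X) ^ (n + 1) = (1 - fps_X :: complex fps) ^ (n - p) * (1 - fps_X) ^ (p + 1)"
    using assms by (simp flip: power_add)
  hence r: "fps_of_poly r =
      fps_const (1 / fact n) * (1 - fps_X) ^ (n + 1) * Abs_fps (\<lambda>m. of_nat m ^ p)"
    by (simp only: r_def fps_of_poly_smult fps_of_poly_mult fps_of_poly_power X q(2) mult_ac)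
  hence eq: "U_monom n p = r"
    unfolding U_monom_def by (rule U_monom_unique)
  have "degree ([:1, -1:] ^ (n - p) * q) \<le> (n - p) + p"
    using q(1) degree_power_le[of "[:1, -1::complex:]" "n - p"]
    by (intro order_trans[OF degree_mult_le] add_mono) auto
  hence "degree r \<le> n" unfolding r_def using assms by simp
  with r eq show ?A ?B by simp_all
qed

lemma degree_U: "degree (U n c) \<le> n"
  unfolding U_def
  by (intro degree_sum_le) (auto intro: order_trans[OF degree_smult_le] degree_U_monom)

lemma fps_U:
  assumes "degree c \<le> n"
  shows "fps_of_poly (U n c) =
    fps_const (1 / fact n) * (1 - fps_X) ^ (n + 1) * Abs_fps (\<lambda>m. poly c (of_nat m))"
proof -
  have "poly c x = (\<Sum>p\<le>n. coeff c p * x ^ p)" for x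
    by (subst poly_altdef, rule sum.mono_neutral_left) (use assms in \<open>auto simp: coeff_eq_0\<close>)
  hence "Abs_fps (\<lambda>m. poly c (of_nat m)) =
      (\<Sum>p\<le>n. fps_const (coeff c p) * Abs_fps (\<lambda>m. of_nat m ^ p))"
    by (intro fps_ext) (simp add: fps_sum_nth)
  thus ?thesis
    by (simp add: U_def fps_of_poly_sum fps_of_poly_smult fps_U_monom sum_distrib_left mult_ac)
qed

lemma U_add: "U n (c + d) = U n c + U n d"
  by (simp add: U_def smult_add_left sum.distrib)

lemma U_smult: "U n (smult a c) = smult a (U n c)"
  using sum_distrib_left[of "[:a:]" "\<lambda>p. smult (coeff c p) (U_monom n p)" "{..n}"] by (simp add: U_def mult.commute)

lemma U_sum: "U n (\<Sum>i\<in>A. f i) = (\<Sum>i\<in>A. U n (f i))"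
  by (induction A rule: infinite_finite_induct) (simp_all add: U_add, simp_all add: U_def)

definition W :: "nat \<Rightarrow> nat \<Rightarrow> complex poly" where
  "W n p = (\<Prod>i<p. [:0, 1:] - of_nat i) * pochhammer [:1, 1:] (n - p)"

lemma degree_W: assumes "p \<le> n" shows "degree (W n p) \<le> n"
proof -
  have *: "degree (\<Prod>i<k. f i) \<le> k" if "\<And>i. degree (f i) \<le> 1" for f :: "nat \<Rightarrow> complex poly" and k
  proof (induction k)
    case (Suc k)
    have "degree (prod f {..<k} * f k) \<le> k + 1"
      by (intro order_trans[OF degree_mult_le] add_mono Suc that)
    thus ?case by simp
  qed simp
  have "degree (W n p) \<le> p + (n - p)"
    unfolding W_def pochhammer_prod atLeast0LessThan
    by (intro order_trans[OF degree_mult_le] add_mono *)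
       (auto intro!: order_trans[OF degree_diff_le_max] order_trans[OF degree_add_le_max]
         simp: of_nat_poly)
  thus ?thesis using assms by simp
qed

lemma poly_pochhammer: "poly (pochhammer q k) x = pochhammer (poly q x) k"
  for q :: "'a :: comm_ring_1 poly"
  by (simp add: pochhammer_prod poly_prod of_nat_poly)

lemma poly_W:
  assumes "p \<le> n"
  shows "poly (W n p) (of_nat m) =
    (if m < p then 0 else fact n * of_nat ((n + (m - p)) choose (m - p)))"
proof (cases "m < p")
  case True
  hence "\<exists>i<p. poly ([:0, 1:] - of_nat i) (of_nat m :: complex) = 0"
    by (intro exI[of _ m]) (auto simp: of_nat_poly)
  thus ?thesis using True by (auto simp: W_def poly_prod)
next
  case False
  define k where "k = m - p"
  have m: "m = p + k" using False by (simp add: k_def)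
  have "poly (\<Prod>i<p. [:0, 1:] - of_nat i) (of_nat m :: complex) = (\<Prod>i<p. of_nat m - of_nat i)"
    by (simp add: poly_prod of_nat_poly)
  also have "\<dots> = pochhammer (of_nat k + 1) p"
    unfolding m by (induction p)
      (simp_all add: prod.lessThan_Suc_shift pochhammer_Suc algebra_simps del: prod.lessThan_Suc)
  finally have "poly (W n p) (of_nat m) =
      pochhammer (of_nat k + 1) p * pochhammer (of_nat k + 1 + of_nat p) (n - p)"
    by (simp add: W_def poly_pochhammer m add_ac)
  also have "\<dots> = pochhammer (of_nat k + 1) n"
    using assms by (subst pochhammer_product[of p n]) simp_all
  also have "\<dots> = fact (n + k) / fact k"
    using pochhammer_product'[of "1::complex" k n]
    by (simp add: pochhammer_fact[symmetric] add_ac)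
  also have "\<dots> = fact n * of_nat ((n + k) choose k)"
    by (simp add: binomial_fact field_simps)
  finally show ?thesis using False by (simp add: k_def)
qed

lemma U_W:
  assumes "p \<le> n"
  shows "U n (W n p) = monom 1 p"
proof -
  define G where "G = Abs_fps (\<lambda>k. of_nat ((n + k) choose k) :: complex)"
  have "inverse ((1 - fps_X) ^ (n + 1)) = G"
    using one_minus_const_fps_X_neg_power'[of "n + 1" "1 :: complex"] by (simp add: G_def)
  hence G: "(1 - fps_X) ^ (n + 1) * G = 1"
    using inverse_mult_eq_1'[of "(1 - fps_X :: complex fps) ^ (n + 1)"]
    by (simp add: fps_power_zeroth del: power_Suc)
  have "Abs_fps (\<lambda>m. poly (W n p) (of_nat m)) = fps_const (fact n) * (fps_X ^ p * G)"
    by (rule fps_ext) (simp add: poly_W[OF assms] G_def fps_X_power_mult_nth)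
  hence "fps_of_poly (U n (W n p)) =
      (fps_const (1 / fact n) * fps_const (fact n)) * fps_X ^ p * ((1 - fps_X) ^ (n + 1) * G)"
    by (simp only: fps_U[OF degree_W[OF assms]] mult_ac)
  also have "\<dots> = fps_X ^ p" unfolding G by simp
  finally have "fps_of_poly (U n (W n p)) = fps_of_poly (monom 1 p)"
    by (simp only: fps_of_poly_monom')
  thus ?thesis by (simp only: fps_of_poly_eq_iff)
qed

lemma poly_eq_off_finite:
  fixes p q :: "complex poly"
  assumes "infinite S" "\<And>x. x \<in> S \<Longrightarrow> poly p x = poly q x"
  shows "p = q"
proof (rule ccontr)
  assume "p \<noteq> q"
  hence "finite {x. poly (p - q) x = 0}" by (intro poly_roots_finite) simp
  moreover have "S \<subseteq> {x. poly (p - q) x = 0}" using assms(2) by auto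
  ultimately show False using assms(1) finite_subset by blast
qed

lemma bij_betw_U: "bij_betw (U n) (polys_upto n) (polys_upto n)"
proof (rule bij_betw_imageI)
  show "inj_on (U n) (polys_upto n)"
  proof (rule inj_onI)
    fix c d assume *: "c \<in> polys_upto n" "d \<in> polys_upto n" and "U n c = U n d"
    hence "fps_of_poly (U n c) = fps_of_poly (U n d)" by simp
    moreover have "fps_const (1 / fact n) * (1 - fps_X) ^ (n + 1) \<noteq> (0 :: complex fps)"
      by simp
    ultimately have eq: "Abs_fps (\<lambda>m. poly c (of_nat m)) = Abs_fps (\<lambda>m. poly d (of_nat m))"
      using * unfolding polys_upto_def by (simp only: fps_U mem_Collect_eq mult_cancel_left) simp
    show "c = d"
    proof (rule poly_eq_off_finite)
      show "infinite (range (of_nat :: nat \<Rightarrow> complex))"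
        by (simp add: finite_image_iff inj_of_nat)
    qed (use eq in \<open>auto simp: fps_eq_iff\<close>)
  qed
  have "q \<in> U n ` polys_upto n" if "degree q \<le> n" for q
  proof
    define c where "c = (\<Sum>p\<le>n. smult (coeff q p) (W n p))"
    show "c \<in> polys_upto n" unfolding c_def polys_upto_def mem_Collect_eq
      by (intro degree_sum_le) (auto intro: order_trans[OF degree_smult_le] degree_W)
    have "U n c = (\<Sum>p\<le>n. monom (coeff q p) p)"
      by (simp add: c_def U_sum U_smult U_W smult_monom)
    thus "q = U n c" using poly_as_sum_of_monoms'[OF that] by simp
  qed
  thus "U n ` polys_upto n = polys_upto n"
    using degree_U by (auto simp: polys_upto_def)
qed

lemma U_inv_monom:
  assumes "p \<le> n"
  shows "U_inv n (monom 1 p) = (\<Prod>i<p. [:0, 1:] - of_nat i) * pochhammer [:1, 1:] (n - p)"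
proof -
  have "U_inv n (U n (W n p)) = W n p"
    unfolding U_inv_def
    by (rule inv_into_f_f) (use bij_betw_U degree_W[OF assms] in \<open>auto simp: bij_betw_def polys_upto_def\<close>)
  thus ?thesis unfolding U_W[OF assms] by (simp only: W_def)
qed


subsection \<open>Well-definedness of \<open>V\<close> and its inverse\<close>

lemma homogenize_ex:
  assumes "degree c \<le> n"
  shows "\<exists>q::complex poly. degree q \<le> n \<and>
    (\<forall>x. 1 + s * x \<noteq> 0 \<longrightarrow> poly q x = (1 + s * x) ^ n * poly c (x / (1 + s * x)))"
proof (intro exI conjI allI impI)
  let ?q = "\<Sum>k\<le>n. smult (coeff c k) ([:0, 1:] ^ k * [:1, s:] ^ (n - k))"
  have "degree ([:0, 1:] ^ k * [:1, s:] ^ (n - k)) \<le> n" if "k \<le> n" for k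
  proof -
    have "degree ([:0, 1:] ^ k * [:1, s:] ^ (n - k)) \<le> k + (n - k)"
      by (intro order_trans[OF degree_mult_le] add_mono order_trans[OF degree_power_le]) auto
    thus ?thesis using that by simp
  qed
  thus "degree ?q \<le> n"
    by (intro degree_sum_le) (auto intro: order_trans[OF degree_smult_le])
  fix x assume x: "1 + s * x \<noteq> 0"
  have "poly c y = (\<Sum>p\<le>n. coeff c p * y ^ p)" for y
    by (subst poly_altdef, rule sum.mono_neutral_left) (use assms in \<open>auto simp: coeff_eq_0\<close>)
  moreover have "(1 + s * x) ^ n * (x / (1 + s * x)) ^ k = x ^ k * (1 + s * x) ^ (n - k)"
    if "k \<le> n" for k
    using x that by (simp add: power_divide power_diff)
  ultimately show "poly ?q x = (1 + s * x) ^ n * poly c (x / (1 + s * x))"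
    by (auto simp: poly_sum sum_distrib_left mult_ac intro!: sum.cong)
qed

lemma infinite_compl_singleton: "infinite {x::complex. x \<noteq> a}"
proof
  assume "finite {x. x \<noteq> a}"
  hence "finite (insert a {x. x \<noteq> a})" by simp
  moreover have "insert a {x. x \<noteq> a} = UNIV" by auto
  ultimately show False by (simp add: infinite_UNIV_char_0)
qed

lemma V_eqI:
  assumes "\<And>x. 1 + x \<noteq> 0 \<Longrightarrow> poly q x = (1 + x) ^ n * poly c (x / (1 + x))"
  shows "V n c = q"
  unfolding V_def
proof (rule the_equality)
  fix q' assume *: "\<forall>x. 1 + x \<noteq> 0 \<longrightarrow> poly q' x = (1 + x) ^ n * poly c (x / (1 + x))"
  show "q' = q"
  proof (rule poly_eq_off_finite[OF infinite_compl_singleton[of "-1"]])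
    fix x :: complex assume "x \<in> {x. x \<noteq> -1}"
    hence "1 + x \<noteq> 0" by (simp add: add_eq_0_iff)
    thus "poly q' x = poly q x" using * assms by simp
  qed
qed (use assms in blast)

lemma V_spec:
  assumes "degree c \<le> n"
  shows poly_V: "\<And>x. 1 + x \<noteq> 0 \<Longrightarrow> poly (V n c) x = (1 + x) ^ n * poly c (x / (1 + x))"
    and degree_V: "degree (V n c) \<le> n"
proof -
  obtain q where q: "degree q \<le> n"
    "\<And>x. 1 + x \<noteq> 0 \<Longrightarrow> poly q x = (1 + x) ^ n * poly c (x / (1 + x))"
    using homogenize_ex[OF assms, of 1] by auto
  have "V n c = q" by (rule V_eqI) (rule q(2))
  thus "\<And>x. 1 + x \<noteq> 0 \<Longrightarrow> poly (V n c) x = (1 + x) ^ n * poly c (x / (1 + x))"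
    "degree (V n c) \<le> n" using q by simp_all
qed

lemma V_preimage:
  assumes "degree c \<le> n"
  shows "\<exists>q. degree q \<le> n \<and> V n q = c \<and>
    (\<forall>x. 1 - x \<noteq> 0 \<longrightarrow> poly q x = (1 - x) ^ n * poly c (x / (1 - x)))"
proof -
  obtain q where q: "degree q \<le> n"
    "\<And>x. 1 - x \<noteq> 0 \<Longrightarrow> poly q x = (1 - x) ^ n * poly c (x / (1 - x))"
    using homogenize_ex[OF assms, of "-1"] by auto
  have "V n q = c"
  proof (rule V_eqI)
    fix x :: complex assume x: "1 + x \<noteq> 0"
    have e: "1 - x / (1 + x) = 1 / (1 + x)" using x by (simp add: field_simps)
    have "poly q (x / (1 + x)) = (1 / (1 + x)) ^ n * poly c x"
      using q(2)[of "x / (1 + x)"] x unfolding e by simp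
    thus "poly c x = (1 + x) ^ n * poly q (x / (1 + x))"
      using x by (simp add: power_divide)
  qed
  thus ?thesis using q by blast
qed

lemma bij_betw_V: "bij_betw (V n) (polys_upto n) (polys_upto n)"
proof (rule bij_betw_imageI)
  show "inj_on (V n) (polys_upto n)"
  proof (rule inj_onI)
    fix c d assume *: "c \<in> polys_upto n" "d \<in> polys_upto n" and eq: "V n c = V n d"
    show "c = d"
    proof (rule poly_eq_off_finite[OF infinite_compl_singleton[of 1]])
      fix y :: complex assume "y \<in> {x. x \<noteq> 1}"
      hence y: "1 - y \<noteq> 0" by simp
      define x where "x = y / (1 - y)"
      have x: "1 + x = 1 / (1 - y)" using y by (simp add: x_def field_simps)
      hence x0: "1 + x \<noteq> 0" using y by simp
      have xy: "x / (1 + x) = y" unfolding x using y by (simp add: x_def)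
      have "(1 + x) ^ n * poly c y = (1 + x) ^ n * poly d y"
        using poly_V[of c n x] poly_V[of d n x] * eq x0 unfolding xy polys_upto_def by simp
      thus "poly c y = poly d y" using x0 by simp
    qed
  qed
  show "V n ` polys_upto n = polys_upto n"
  proof
    show "polys_upto n \<subseteq> V n ` polys_upto n"
      using V_preimage unfolding polys_upto_def by blast
  qed (auto simp: polys_upto_def degree_V)
qed

lemma poly_V_inv:
  assumes "degree c \<le> n" "1 - x \<noteq> 0"
  shows "poly (V_inv n c) x = (1 - x) ^ n * poly c (x / (1 - x))"
proof -
  obtain q where q: "degree q \<le> n" "V n q = c"
    "poly q x = (1 - x) ^ n * poly c (x / (1 - x))"
    using V_preimage[OF assms(1)] assms(2) by blast
  have "V_inv n (V n q) = q"
    unfolding V_inv_def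
    by (rule inv_into_f_f) (use bij_betw_V q(1) in \<open>auto simp: bij_betw_def polys_upto_def\<close>)
  thus ?thesis using q by simp
qed

end

theory Submission
  imports Defs
begin

text \<open>The map \<open>V\<^sub>n U\<^sub>n\<close> sends \<open>n! \<cdot> (x choose p)\<close> to \<open>x ^ p\<close>, because
  \<open>\<Sum>\<^sub>m (m choose p) x ^ m = x ^ p / (1 - x) ^ (p + 1)\<close>. In the binomial basis the shift by \<open>\<gamma>\<close>
  acts through Vandermonde's identity
  \<open>(x + \<gamma> choose p) = \<Sum>\<^sub>i (\<gamma> choose p - i) (x choose i)\<close>, which is the matrix of \<open>B\<^sub>\<gamma>\<close> in the
  monomial basis.\<close>

text \<open>The rising factor of \<open>W p p\<close> is empty, so this is x choose p. Going through
  \<open>W\<close> makes \<open>degree_W\<close> and \<open>U_W\<close> available.\<close>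

definition binom_poly :: "nat \<Rightarrow> complex poly" where
  "binom_poly p = smult (1 / fact p) (W p p)"

lemma poly_binom_poly: "poly (binom_poly p) x = x gchoose p"
  by (simp add: binom_poly_def W_def poly_prod of_nat_poly gbinomial_prod_rev atLeast0LessThan)

lemma degree_binom_poly: "degree (binom_poly p) \<le> p"
  unfolding binom_poly_def by (intro order_trans[OF degree_smult_le] degree_W) simp

text \<open>The case n = p of \<open>U_W\<close>, where the factor 1 / p! of \<open>U\<close> is the
  one built into \<open>binom_poly\<close>.\<close>

lemma fps_binom_poly:
  "(1 - fps_X) ^ (p + 1) * Abs_fps (\<lambda>m. poly (binom_poly p) (of_nat m)) = fps_X ^ p"
proof -
  have "Abs_fps (\<lambda>m. poly (binom_poly p) (of_nat m)) =
      fps_const (1 / fact p) * Abs_fps (\<lambda>m. poly (W p p) (of_nat m))"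
    by (rule fps_ext) (simp add: binom_poly_def)
  hence "(1 - fps_X) ^ (p + 1) * Abs_fps (\<lambda>m. poly (binom_poly p) (of_nat m)) =
      fps_of_poly (U p (W p p))"
    by (simp only: fps_U[OF degree_W[OF order_refl]] mult_ac)
  thus ?thesis by (simp only: U_W[OF order_refl] fps_of_poly_monom')
qed

text \<open>The generating function absorbs p + 1 of the n + 1 factors 1 - x, leaving n - p of
  them.\<close>

lemma U_binom_poly:
  assumes "p \<le> n"
  shows "U n (binom_poly p) = smult (1 / fact n) ([:1, -1:] ^ (n - p) * monom 1 p)"
proof -
  have X: "fps_of_poly [:1, -1 :: complex:] = 1 - fps_X"
    by (simp add: fps_of_poly_linear')
  have pow: "(1 - fps_X) ^ (n + 1) = (1 - fps_X :: complex fps) ^ (n - p) * (1 - fps_X) ^ (p + 1)"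
    using assms by (simp flip: power_add)
  have "degree (binom_poly p) \<le> n"
    using degree_binom_poly assms by (rule order_trans)
  hence "fps_of_poly (U n (binom_poly p)) = fps_const (1 / fact n) * ((1 - fps_X) ^ (n - p) *
      ((1 - fps_X) ^ (p + 1) * Abs_fps (\<lambda>m. poly (binom_poly p) (of_nat m))))"
    by (simp only: fps_U pow mult.assoc)
  also have "\<dots> = fps_of_poly (smult (1 / fact n) ([:1, -1:] ^ (n - p) * monom 1 p))"
    by (simp only: fps_binom_poly fps_of_poly_smult fps_of_poly_mult fps_of_poly_power X
        fps_of_poly_monom')
  finally show ?thesis by (simp only: fps_of_poly_eq_iff)
qed

text \<open>The inverse of \<open>V n\<close> after \<open>U n\<close> on degree at most n;
  \<open>fact n\<close> cancels the factor 1 / n! in \<open>U\<close>.\<close>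

definition to_binom :: "nat \<Rightarrow> complex poly \<Rightarrow> complex poly" where
  "to_binom n d = (\<Sum>p\<le>n. smult (fact n * coeff d p) (binom_poly p))"

lemma degree_to_binom: "degree (to_binom n d) \<le> n"
  unfolding to_binom_def
  by (intro degree_sum_le)
    (auto intro: order_trans[OF degree_smult_le] order_trans[OF degree_binom_poly])

lemma poly_to_binom: "poly (to_binom n d) x = fact n * (\<Sum>p\<le>n. coeff d p * (x gchoose p))"
  by (simp add: to_binom_def poly_sum poly_binom_poly sum_distrib_left mult_ac)

text \<open>Both sides send x ^ p to (1 - x) ^ (n - p) * x ^ p. Values away from 1 suffice to
  identify the polynomials.\<close>

lemma U_to_binom:
  assumes "degree d \<le> n"
  shows "U n (to_binom n d) = V_inv n d"
proof (rule poly_eq_off_finite[OF infinite_compl_singleton[of 1]])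
  fix x :: complex assume "x \<in> {x. x \<noteq> 1}"
  hence x: "1 - x \<noteq> 0" by simp
  have d: "poly d y = (\<Sum>p\<le>n. coeff d p * y ^ p)" for y
    by (subst poly_altdef, rule sum.mono_neutral_left) (use assms in \<open>auto simp: coeff_eq_0\<close>)
  have "poly (U n (to_binom n d)) x = (\<Sum>p\<le>n. coeff d p * ((1 - x) ^ (n - p) * x ^ p))"
    by (simp add: to_binom_def U_sum U_smult U_binom_poly poly_sum poly_monom)
  also have "\<dots> = (\<Sum>p\<le>n. (1 - x) ^ n * (coeff d p * (x / (1 - x)) ^ p))"
    by (intro sum.cong) (use x in \<open>auto simp: power_divide power_diff\<close>)
  also have "\<dots> = poly (V_inv n d) x"
    by (simp add: poly_V_inv[OF assms x] d sum_distrib_left)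
  finally show "poly (U n (to_binom n d)) x = poly (V_inv n d) x" .
qed

text \<open>Replaces the bound \<open>degree d\<close> by a fixed n, so that sums over p and i can
  be exchanged.\<close>

lemma coeff_B:
  assumes "degree d \<le> n"
  shows "coeff (B \<gamma> d) i = (\<Sum>p\<le>n. if i \<le> p then coeff d p * (\<gamma> gchoose (p - i)) else 0)"
proof -
  have "coeff (B \<gamma> d) i =
      (\<Sum>p\<le>degree d. if i \<le> p then coeff d p * (\<gamma> gchoose (p - i)) else 0)"
    by (simp add: B_def coeff_sum if_distrib cong: if_cong)
  also have "\<dots> = (\<Sum>p\<le>n. if i \<le> p then coeff d p * (\<gamma> gchoose (p - i)) else 0)"
    by (rule sum.mono_neutral_left) (use assms in \<open>auto simp: coeff_eq_0\<close>)
  finally show ?thesis .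
qed

lemma degree_B:
  assumes "degree d \<le> n"
  shows "degree (B \<gamma> d) \<le> n"
  by (rule degree_le) (auto simp: coeff_B[OF assms] intro!: sum.neutral)

lemma E_to_binom:
  assumes "degree d \<le> n"
  shows "E \<gamma> (to_binom n d) = to_binom n (B \<gamma> d)"
proof (rule poly_ext)
  fix x
  have "(\<Sum>i\<le>n. coeff (B \<gamma> d) i * (x gchoose i)) =
      (\<Sum>i\<le>n. \<Sum>p\<le>n. if i \<le> p then coeff d p * (\<gamma> gchoose (p - i)) * (x gchoose i) else 0)"
    by (auto simp: coeff_B[OF assms] sum_distrib_right intro!: sum.cong)
  also have "\<dots> =
      (\<Sum>p\<le>n. \<Sum>i\<le>n. if i \<le> p then coeff d p * (\<gamma> gchoose (p - i)) * (x gchoose i) else 0)"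
    by (rule sum.swap)
  \<comment> \<open>Dropping the zero terms with i > p leaves exactly a Vandermonde sum for each
    p.\<close>
  also have "\<dots> = (\<Sum>p\<le>n. \<Sum>i\<le>p. coeff d p * (\<gamma> gchoose (p - i)) * (x gchoose i))"
    by (intro sum.cong refl sum.mono_neutral_cong_right) auto
  also have "\<dots> = (\<Sum>p\<le>n. coeff d p * ((x + \<gamma>) gchoose p))"
    by (simp add: gbinomial_Vandermonde[symmetric] atLeast0AtMost sum_distrib_left mult_ac)
  finally show "poly (E \<gamma> (to_binom n d)) x = poly (to_binom n (B \<gamma> d)) x"
    by (simp add: E_def poly_pcompose poly_to_binom add.commute)
qed

theorem theorem6p2:
  fixes n :: nat and \<beta> :: complex and c :: "complex poly"
  assumes "c \<in> polys_upto n"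
  shows "(U n \<circ> E (of_nat n * \<beta>) \<circ> U_inv n) c = (V_inv n \<circ> B (of_nat n * \<beta>) \<circ> V n) c"
proof -
  have c: "degree c \<le> n" using assms by (simp add: polys_upto_def)
  have "V_inv n (V n c) = c"
    unfolding V_inv_def by (rule bij_betw_inv_into_left[OF bij_betw_V assms])
  hence "U n (to_binom n (V n c)) = c"
    by (simp add: U_to_binom degree_V c)
  moreover have "U_inv n (U n (to_binom n (V n c))) = to_binom n (V n c)"
    unfolding U_inv_def
    by (rule bij_betw_inv_into_left[OF bij_betw_U]) (simp add: polys_upto_def degree_to_binom)
  ultimately have "U_inv n c = to_binom n (V n c)" by simp
  \<comment> \<open>Now \<open>E\<close> passes through \<open>to_binom\<close> as \<open>B\<close>,
    and \<open>U_to_binom\<close> turns the outer \<open>U n\<close> into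
    \<open>V_inv n\<close>.\<close>
  thus ?thesis by (simp add: E_to_binom U_to_binom degree_B degree_V c)
qed

end
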